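(* The $\mathbb{Z}$-module $\Xi$ has a basis consisting of all shifted quasi-symmetric functions $\theta_\alpha$ such that $I(\alpha)$ contains no internal peak.
   Context: A composition $\alpha=[\alpha_1,\ldots,\alpha_k]$ of $n$ ($\alpha\vDash n$) is an ordered list of positive integers summing to $n$; $k(\alpha)=k$; the empty composition $0$ is the composition of $0$. $I(\alpha)=\{\alpha_1,\alpha_1+\alpha_2,\ldots,\alpha_1+\cdots+\alpha_{k-1}\}\subset[n-1]$, $A+1=\{a+1:a\in A\}$. $M_\alpha=\sum_{i_1<\cdots<i_k}x_{i_1}^{\alpha_1}\cdots x_{i_k}^{\alpha_k}$, $M_0=1$. For $\alpha\vDash n$, $\theta_\alpha=\sum_{\beta\vDash n,\ I(\alpha)\subset I(\beta)\cup(I(\beta)+1)}2^{k(\beta)}M_\beta$, $\theta_0=1$. $\theta_\alpha$ ($\alpha\vDash n$) is a shifted quasi-symmetric function if $n\le 1$ or $\alpha_1>1$. $\Xi$ is the $\mathbb{Z}$-span of all shifted quasi-symmetric functions. For such $\alpha\vDash n$, an internal peak of $I(\alpha)$ is an element $i\in I(\alpha)$ with $i-1\notin I(\alpha)$, $i+1\notin I(\alpha)$, and $i\in\{3,\ldots,n-2\}$. *)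

theory Defs
  imports
    Complex_Main
    "HOL-Library.Function_Algebras"
    "HOL-Library.Poly_Mapping"
begin

definition is_composition :: "nat list \<Rightarrow> bool"
  where "is_composition \<alpha> \<longleftrightarrow> 0 \<notin> set \<alpha>"

definition compositions :: "nat \<Rightarrow> nat list set"
  where "compositions n = {\<alpha>. is_composition \<alpha> \<and> sum_list \<alpha> = n}"

definition descent_set :: "nat list \<Rightarrow> nat set"
  where "descent_set \<alpha> = {sum_list (take j \<alpha>) |j. 0 < j \<and> j < length \<alpha>}"

lemma finite_compositions: "finite (compositions n)"
proof (rule finite_subset)
  have "length \<alpha> \<le> sum_list \<alpha>" if "0 \<notin> set \<alpha>" for \<alpha> :: "nat list"
    using that by (induction \<alpha>) auto
  moreover have "x \<le> sum_list \<alpha>" if "x \<in> set \<alpha>" for \<alpha> :: "nat list" and x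
    using that by (auto intro: member_le_sum_list)
  ultimately show "compositions n \<subseteq> {xs. set xs \<subseteq> {..n} \<and> length xs \<le> n}"
    by (auto simp: compositions_def is_composition_def)
  show "finite {xs. set xs \<subseteq> {..n} \<and> length xs \<le> n}"
    by (rule finite_lists_length_le) simp
qed


text \<open>
  Formal power series with integer coefficients in countably many commuting variables, given
  by their coefficient functions: a monomial is a finitely supported exponent vector. The
  variables \<open>x\<^sub>1, x\<^sub>2, \<dots>\<close> are numbered from 0, which does not affect anything
  below since only the order of the indices matters. Addition is that of
  \<^theory>\<open>HOL-Library.Function_Algebras\<close>, that is, coefficientwise.
\<close>

type_synonym power_series = "(nat \<Rightarrow>\<^sub>0 nat) \<Rightarrow> int"

definition zscale :: "int \<Rightarrow> power_series \<Rightarrow> power_series"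
  where "zscale c f = (\<lambda>m. c * f m)"

global_interpretation zmod: module zscale
  by unfold_locales (auto simp: zscale_def fun_eq_iff algebra_simps)

definition monomial_of :: "nat list \<Rightarrow> nat list \<Rightarrow> (nat \<Rightarrow>\<^sub>0 nat)"
  where "monomial_of is \<alpha> = (\<Sum>j<length \<alpha>. Poly_Mapping.single (is ! j) (\<alpha> ! j))"

text \<open>
  The coefficient of a monomial \<open>m\<close> in the infinite sum defining \<open>M\<^sub>\<alpha>\<close>
  over all \<open>i\<^sub>1 < \<cdots> < i\<^sub>k\<close> is the number of summands equal to \<open>m\<close>. This
  number is finite for every composition, as shown by \<open>finite_index_lists\<close> below.
\<close>

definition index_lists :: "nat list \<Rightarrow> (nat \<Rightarrow>\<^sub>0 nat) \<Rightarrow> nat list set"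
  where "index_lists \<alpha> m =
    {is. length is = length \<alpha> \<and> sorted_wrt (<) is \<and> monomial_of is \<alpha> = m}"

definition monomial_qsym :: "nat list \<Rightarrow> power_series"
  where "monomial_qsym \<alpha> = (\<lambda>m. int (card (index_lists \<alpha> m)))"

lemma finite_index_lists:
  assumes "is_composition \<alpha>"
  shows "finite (index_lists \<alpha> m)"
proof (rule finite_subset)
  show "index_lists \<alpha> m \<subseteq> {xs. set xs \<subseteq> Poly_Mapping.keys m \<and> length xs = length \<alpha>}"
  proof (intro subsetI CollectI conjI)
    fix xs x assume xs: "xs \<in> index_lists \<alpha> m"
    then show "length xs = length \<alpha>" by (simp add: index_lists_def)
    assume "x \<in> set xs"
    then obtain j where j: "j < length \<alpha>" "x = xs ! j"
      using \<open>length xs = length \<alpha>\<close> by (metis in_set_conv_nth)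
    have "0 < \<alpha> ! j"
      using assms j(1) by (metis gr0I is_composition_def nth_mem)
    also have "\<dots> = Poly_Mapping.lookup (Poly_Mapping.single (xs ! j) (\<alpha> ! j)) x"
      using j by simp
    also have "\<dots> \<le> (\<Sum>l<length \<alpha>. Poly_Mapping.lookup (Poly_Mapping.single (xs ! l) (\<alpha> ! l)) x)"
      using j(1) by (intro member_le_sum) auto
    also have "\<dots> = Poly_Mapping.lookup m x"
      using xs by (auto simp: index_lists_def monomial_of_def lookup_sum)
    finally show "x \<in> Poly_Mapping.keys m" by (simp add: in_keys_iff)
  qed
  show "finite {xs. set xs \<subseteq> Poly_Mapping.keys m \<and> length xs = length \<alpha>}"
    by (rule finite_lists_length_eq) simp
qed

lemma monomial_qsym_Nil: "monomial_qsym [] = (\<lambda>m. if m = 0 then 1 else 0)"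
proof
  fix m
  have "index_lists [] m = (if m = 0 then {[]} else {})"
    by (auto simp: index_lists_def monomial_of_def)
  then show "monomial_qsym [] m = (if m = 0 then 1 else 0)"
    by (simp add: monomial_qsym_def)
qed

text \<open>
  For the empty composition the formula gives the constant series 1, so this case needs no
  separate clause; see \<open>theta_Nil\<close>.
\<close>

definition theta :: "nat list \<Rightarrow> power_series"
  where "theta \<alpha> =
    (\<Sum>\<beta> \<in> {\<beta> \<in> compositions (sum_list \<alpha>).
              descent_set \<alpha> \<subseteq> descent_set \<beta> \<union> (\<lambda>b. b + 1) ` descent_set \<beta>}.
       zscale (2 ^ length \<beta>) (monomial_qsym \<beta>))"

lemma theta_Nil: "theta [] = (\<lambda>m. if m = 0 then 1 else 0)"
proof -
  have "\<beta> = []" if "0 \<notin> set \<beta>" "sum_list \<beta> = 0" for \<beta> :: "nat list"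
    using that by (cases \<beta>) auto
  then have "{\<beta> \<in> compositions (sum_list []).
      descent_set [] \<subseteq> descent_set \<beta> \<union> (\<lambda>b. b + 1) ` descent_set \<beta>} = {[]}"
    by (auto simp: compositions_def is_composition_def descent_set_def)
  then show ?thesis
    unfolding theta_def by (simp add: monomial_qsym_Nil zscale_def fun_eq_iff)
qed

text \<open>The compositions \<open>\<alpha>\<close> whose \<open>\<theta>\<^sub>\<alpha>\<close> is a shifted quasi-symmetric function.\<close>

definition shifted_composition :: "nat list \<Rightarrow> bool"
  where "shifted_composition \<alpha> \<longleftrightarrow> is_composition \<alpha> \<and> (sum_list \<alpha> \<le> 1 \<or> hd \<alpha> > 1)"

definition Xi :: "power_series set"
  where "Xi = zmod.span {theta \<alpha> |\<alpha>. shifted_composition \<alpha>}"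

definition internal_peak :: "nat list \<Rightarrow> nat \<Rightarrow> bool"
  where "internal_peak \<alpha> i \<longleftrightarrow>
    i \<in> descent_set \<alpha> \<and> i - 1 \<notin> descent_set \<alpha> \<and> i + 1 \<notin> descent_set \<alpha> \<and>
    i \<in> {3..sum_list \<alpha> - 2}"

definition peak_free_shifted_compositions :: "nat list set"
  where "peak_free_shifted_compositions =
    {\<alpha>. shifted_composition \<alpha> \<and> (\<nexists>i. internal_peak \<alpha> i)}"

end

theory Submission
  imports Defs
begin

text \<open>
  Up to the factor \<open>2 ^ length \<beta>\<close>, the coefficient of \<open>M\<^sub>\<beta>\<close> in
  \<open>\<theta>\<^sub>\<alpha>\<close> is the product over \<open>i \<in> I(\<alpha>)\<close> of \<open>e\<^sub>i = 1 - x\<^sub>i\<^sub>-\<^sub>1 x\<^sub>i\<close>, where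
  \<open>x\<^sub>i\<close> indicates \<open>i \<notin> I(\<beta>)\<close>. As the \<open>x\<^sub>i\<close> are idempotent,
  \<open>(1 - e\<^sub>i\<^sub>-\<^sub>1) (1 - e\<^sub>i\<^sub>+\<^sub>1) e\<^sub>i = 0\<close>. Hence at an internal peak \<open>i\<close> one can express
  \<open>\<theta>\<^sub>\<alpha>\<close> by the three functions obtained by adding \<open>i - 1\<close>, \<open>i + 1\<close> or both to
  \<open>I(\<alpha>)\<close>, and iterating this gives spanning. Conversely, if \<open>I(\<alpha>)\<close> has no internal peak and
  \<open>A\<close> is its complement in \<open>{2..n-1}\<close>, then for the \<open>\<beta>\<close> whose descent set is the
  complement of \<open>A \<union> (A - 1)\<close> the coefficient of \<open>M\<^sub>\<beta>\<close> in \<open>\<theta>\<^sub>\<alpha>\<^sub>'\<close> is nonzero iff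
  \<open>I(\<alpha>') \<subseteq> I(\<alpha>)\<close>. So the matrix of coefficients is triangular.
\<close>

section \<open>Compositions and their descent sets\<close>

lemma descent_set_Nil [simp]: "descent_set [] = {}"
  by (simp add: descent_set_def)

text \<open>The total of a composition is never one of its descents, so appending a part adds
  exactly the old total and keeps every earlier partial sum. Inductions on compositions therefore
  peel off the last part.\<close>

lemma descent_set_snoc:
  "descent_set (xs @ [a]) = (if xs = [] then {} else insert (sum_list xs) (descent_set xs))"
proof (cases "xs = []")
  case False
  have "descent_set (xs @ [a]) = (\<lambda>j. sum_list (take j (xs @ [a]))) ` {0<..<Suc (length xs)}"
    by (simp only: descent_set_def image_def) (auto simp del: take_append)
  also have "{0<..<Suc (length xs)} = insert (length xs) {0<..<length xs}"
    using False by auto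
  also have "(\<lambda>j. sum_list (take j (xs @ [a]))) ` \<dots> =
      insert (sum_list xs) ((\<lambda>j. sum_list (take j xs)) ` {0<..<length xs})"
    by (auto intro!: arg_cong2[where f = insert] image_cong)
  also have "(\<lambda>j. sum_list (take j xs)) ` {0<..<length xs} = descent_set xs"
    by (auto simp: descent_set_def)
  finally show ?thesis using False by simp
qed (auto simp: descent_set_def)

lemma is_composition_snoc [simp]:
  "is_composition (xs @ [a]) \<longleftrightarrow> is_composition xs \<and> 0 < a"
  by (auto simp: is_composition_def)

lemma sum_list_composition_pos: "is_composition xs \<Longrightarrow> xs \<noteq> [] \<Longrightarrow> 0 < sum_list xs"
  by (cases xs) (auto simp: is_composition_def)

lemma descent_set_subset: "is_composition xs \<Longrightarrow> descent_set xs \<subseteq> {1..<sum_list xs}"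
proof (induction xs rule: rev_induct)
  case (snoc a xs)
  then show ?case using sum_list_composition_pos[of xs]
    by (auto simp: descent_set_snoc subset_iff)
qed simp

lemma finite_descent_set: "is_composition xs \<Longrightarrow> finite (descent_set xs)"
  using descent_set_subset finite_subset by blast

text \<open>The largest descent is the total of all parts but the last, so it fixes the last part;
  the remaining descents determine the rest by induction.\<close>

lemma composition_eqI:
  assumes "is_composition xs" "is_composition ys"
    and "sum_list xs = sum_list ys" "descent_set xs = descent_set ys"
  shows "xs = ys"
  using assms
proof (induction xs arbitrary: ys rule: rev_induct)
  case Nil
  then show ?case using sum_list_composition_pos[of ys] by (metis less_irrefl sum_list.Nil)
next
  case (snoc a xs)
  from snoc.prems obtain b zs where ys: "ys = zs @ [b]"
    by (cases ys rule: rev_cases) auto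
  have xs: "descent_set xs \<subseteq> {1..<sum_list xs}" and zs: "descent_set zs \<subseteq> {1..<sum_list zs}"
    using snoc.prems ys descent_set_subset by auto
  show ?case
  proof (cases "xs = [] \<or> zs = []")
    case True
    then show ?thesis using snoc.prems ys
      by (auto simp: descent_set_snoc split: if_splits)
  next
    case False
    then have eq: "insert (sum_list xs) (descent_set xs) = insert (sum_list zs) (descent_set zs)"
      using snoc.prems ys by (simp add: descent_set_snoc)
    have sum: "sum_list xs = sum_list zs"
    \<comment> \<open>Each total lies in the other set, whose elements are bounded by the other
      total.\<close>
    proof (rule antisym)
      show "sum_list xs \<le> sum_list zs" using equalityD1[OF eq] zs by auto
      show "sum_list zs \<le> sum_list xs" using equalityD2[OF eq] xs by auto
    qed
    have "descent_set xs = descent_set zs"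
      using eq sum xs zs by (subst (asm) sum, subst (asm) insert_ident) auto
    then show ?thesis
      using snoc.IH[of zs] snoc.prems sum ys by auto
  qed
qed

text \<open>The last part must start at \<open>Max S\<close>, so strong induction on
  \<open>n\<close> first builds a composition of \<open>Max S\<close> from the smaller
  elements.\<close>

lemma composition_with_descent_set:
  assumes "S \<subseteq> {1..<n}"
  obtains xs where "is_composition xs" "sum_list xs = n" "descent_set xs = S"
proof -
  have "\<exists>xs. is_composition xs \<and> sum_list xs = n \<and> descent_set xs = S"
    using assms
  proof (induction n arbitrary: S rule: less_induct)
    case (less n)
    have fin: "finite S" using less.prems finite_subset by blast
    consider "n = 0" | "n > 0" "S = {}" | "S \<noteq> {}" by blast
    then show ?case
    proof cases
      case 1
      then show ?thesis using less.prems by (intro exI[of _ "[]"]) (auto simp: is_composition_def)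
    next
      case 2
      then show ?thesis
        by (intro exI[of _ "[n]"]) (auto simp: is_composition_def descent_set_def)
    next
      case 3
      define m where "m = Max S"
      have m: "m \<in> S" "\<And>i. i \<in> S \<Longrightarrow> i \<le> m"
        using fin 3 by (auto simp: m_def)
      have mn: "0 < m" "m < n" using m(1) less.prems by auto
      have "S - {m} \<subseteq> {1..<m}"
      proof
        fix i assume "i \<in> S - {m}"
        then show "i \<in> {1..<m}" using m(2)[of i] less.prems by auto
      qed
      from less.IH[OF mn(2) this] obtain xs where
        xs: "is_composition xs" "sum_list xs = m" "descent_set xs = S - {m}" by blast
      moreover have "xs \<noteq> []" using xs(2) mn(1) by auto
      ultimately have "descent_set (xs @ [n - m]) = S"
        using m(1) by (simp add: descent_set_snoc insert_absorb)
      then show ?thesis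
        using xs(1,2) mn(2) by (intro exI[of _ "xs @ [n - m]"]) simp
    qed
  qed
  then show thesis using that by blast
qed

text \<open>For totals at most 1 the descent set is empty, so both cases of the definition become
  one condition on descents.\<close>

lemma shifted_composition_iff:
  "shifted_composition \<alpha> \<longleftrightarrow> is_composition \<alpha> \<and> 1 \<notin> descent_set \<alpha>"
proof (cases "is_composition \<alpha> \<and> sum_list \<alpha> > 1")
  case False
  then show ?thesis
    using descent_set_subset[of \<alpha>] by (auto simp: shifted_composition_def)
next
  case True
  then obtain a as where \<alpha>: "\<alpha> = a # as" by (cases \<alpha>) auto
  have a: "a > 0" using True \<alpha> by (auto simp: is_composition_def)
  have "1 \<in> descent_set \<alpha> \<longleftrightarrow> a = 1"
  proof
    assume "1 \<in> descent_set \<alpha>"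
    then obtain j where "0 < j" "sum_list (take j \<alpha>) = 1"
      by (auto simp: descent_set_def)
    then show "a = 1" using a \<alpha> by (cases j) auto
  next
    assume "a = 1"
    moreover from this have "as \<noteq> []" using True \<alpha> by auto
    ultimately show "1 \<in> descent_set \<alpha>"
      using \<alpha> by (auto simp: descent_set_def intro!: exI[of _ 1])
  qed
  then show ?thesis using True \<alpha> a by (auto simp: shifted_composition_def)
qed

section \<open>Coefficients of monomial quasi-symmetric functions\<close>

lemma lookup_monomial_of_nth:
  assumes "length is = length \<alpha>" "sorted_wrt (<) is" "j < length \<alpha>"
  shows "Poly_Mapping.lookup (monomial_of is \<alpha>) (is ! j) = \<alpha> ! j"
proof -
  have "distinct is" using assms(2) by (simp add: strict_sorted_iff)
  then have "Poly_Mapping.lookup (monomial_of is \<alpha>) (is ! j) =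
      (\<Sum>l<length \<alpha>. if l = j then \<alpha> ! l else 0)"
    unfolding monomial_of_def lookup_sum using assms
    by (intro sum.cong) (auto simp: lookup_single when_def nth_eq_iff_index_eq)
  then show ?thesis using assms(3) by simp
qed

lemma keys_monomial_of:
  assumes "length is = length \<alpha>" "sorted_wrt (<) is" "is_composition \<alpha>"
  shows "Poly_Mapping.keys (monomial_of is \<alpha>) = set is"
proof
  show "Poly_Mapping.keys (monomial_of is \<alpha>) \<subseteq> set is"
  proof
    fix x assume "x \<in> Poly_Mapping.keys (monomial_of is \<alpha>)"
    then obtain l where "l < length \<alpha>" "Poly_Mapping.lookup (Poly_Mapping.single (is ! l) (\<alpha> ! l)) x \<noteq> 0"
      unfolding monomial_of_def in_keys_iff lookup_sum by (auto elim: sum.not_neutral_contains_not_neutral)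
    then show "x \<in> set is"
      using assms(1) by (auto simp: lookup_single when_def split: if_splits)
  qed
  show "set is \<subseteq> Poly_Mapping.keys (monomial_of is \<alpha>)"
  proof
    fix x assume "x \<in> set is"
    then obtain j where j: "j < length \<alpha>" "x = is ! j"
      using assms(1) by (metis in_set_conv_nth)
    then have "\<alpha> ! j \<noteq> 0" using assms(3) by (metis is_composition_def nth_mem)
    then show "x \<in> Poly_Mapping.keys (monomial_of is \<alpha>)"
      using lookup_monomial_of_nth[OF assms(1,2) j(1)] j by (simp add: in_keys_iff)
  qed
qed

text \<open>The support of the monomial, listed in increasing order, forces the index list, and its
  exponents then force the parts. Evaluation at this monomial thus extracts the coefficient of
  \<open>M\<^sub>\<beta>\<close>.\<close>

lemma monomial_qsym_monomial_of:
  assumes "is_composition \<gamma>" "is_composition \<beta>"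
  shows "monomial_qsym \<gamma> (monomial_of [0..<length \<beta>] \<beta>) = of_bool (\<gamma> = \<beta>)"
proof -
  let ?m = "monomial_of [0..<length \<beta>] \<beta>"
  have "is = [0..<length \<beta>] \<and> \<gamma> = \<beta>" if "is \<in> index_lists \<gamma> ?m" for "is"
  proof -
    have *: "length is = length \<gamma>" "sorted_wrt (<) is" "monomial_of is \<gamma> = ?m"
      using that by (auto simp: index_lists_def)
    have "set is = set [0..<length \<beta>]"
      using keys_monomial_of[OF *(1,2) assms(1)]
        keys_monomial_of[of "[0..<length \<beta>]" \<beta>] assms(2) *(3) by simp
    then have eq: "is = [0..<length \<beta>]"
      using *(2) by (intro strict_sorted_equal) auto
    have len: "length \<gamma> = length \<beta>" using *(1) eq by (metis length_upt minus_nat.diff_0)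
    have "\<gamma> ! j = \<beta> ! j" if j: "j < length \<gamma>" for j
    proof -
      have "\<gamma> ! j = Poly_Mapping.lookup ?m (is ! j)"
        using lookup_monomial_of_nth[OF *(1,2) j] unfolding *(3) by (rule sym)
      also have "\<dots> = \<beta> ! j"
        unfolding eq using j len by (intro lookup_monomial_of_nth) auto
      finally show ?thesis .
    qed
    with len have "\<gamma> = \<beta>" by (rule nth_equalityI)
    with eq show ?thesis ..
  qed
  moreover have "[0..<length \<beta>] \<in> index_lists \<beta> ?m"
    by (simp add: index_lists_def)
  ultimately have "index_lists \<gamma> ?m = (if \<gamma> = \<beta> then {[0..<length \<beta>]} else {})"
    by (simp split: if_split) blast
  then show ?thesis by (simp add: monomial_qsym_def)
qed

section \<open>Coefficients of theta\<close>

lemma sum_power_series_apply: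
  fixes f :: "'a \<Rightarrow> power_series"
  shows "finite A \<Longrightarrow> (\<Sum>x\<in>A. f x) m = (\<Sum>x\<in>A. f x m)"
  by (induction A rule: finite_induct) auto

definition double_cover :: "nat list \<Rightarrow> nat set"
  where "double_cover \<beta> = descent_set \<beta> \<union> (\<lambda>b. b + 1) ` descent_set \<beta>"

text \<open>With a 0/1 indicator the index set depends only on the total, so linear relations
  between thetas of equal degree reduce to relations between indicators.\<close>

lemma theta_apply:
  "theta \<alpha> m = (\<Sum>\<beta>\<in>compositions (sum_list \<alpha>).
     of_bool (descent_set \<alpha> \<subseteq> double_cover \<beta>) * (2 ^ length \<beta> * monomial_qsym \<beta> m))"
  unfolding theta_def double_cover_def
  by (subst sum_power_series_apply)
    (auto simp: finite_compositions zscale_def sum.inter_filter of_bool_def intro!: sum.cong)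

lemma theta_monomial_of:
  assumes "is_composition \<beta>"
  shows "theta \<alpha> (monomial_of [0..<length \<beta>] \<beta>) =
    (if sum_list \<beta> = sum_list \<alpha> \<and> descent_set \<alpha> \<subseteq> double_cover \<beta> then 2 ^ length \<beta> else 0)"
proof -
  have "theta \<alpha> (monomial_of [0..<length \<beta>] \<beta>) = (\<Sum>\<gamma>\<in>compositions (sum_list \<alpha>).
      if \<gamma> = \<beta> then of_bool (descent_set \<alpha> \<subseteq> double_cover \<beta>) * 2 ^ length \<beta> else 0)"
    unfolding theta_apply
    by (intro sum.cong) (auto simp: compositions_def monomial_qsym_monomial_of assms)
  then show ?thesis
    using assms by (simp add: finite_compositions) (simp add: compositions_def)
qed

section \<open>Triangularity\<close>

lemma peak_free_test_composition:
  assumes "\<alpha> \<in> peak_free_shifted_compositions"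
  obtains \<beta> where "is_composition \<beta>" "sum_list \<beta> = sum_list \<alpha>"
    "\<And>\<alpha>'. shifted_composition \<alpha>' \<Longrightarrow> sum_list \<alpha>' = sum_list \<alpha> \<Longrightarrow>
       descent_set \<alpha>' \<subseteq> double_cover \<beta> \<longleftrightarrow> descent_set \<alpha>' \<subseteq> descent_set \<alpha>"
proof -
  define n where "n = sum_list \<alpha>"
  define A where "A = {2..<n} - descent_set \<alpha>"
  have peak: "\<not> internal_peak \<alpha> i" for i
    using assms by (auto simp: peak_free_shifted_compositions_def)
  \<comment> \<open>The largest subset of \<open>{1..<n}\<close> whose elements and their successors
    all avoid \<open>A\<close>.\<close>
  define S where "S = {j \<in> {1..<n}. j \<notin> A \<and> j + 1 \<notin> A}"
  obtain \<beta> where \<beta>: "is_composition \<beta>" "sum_list \<beta> = n" "descent_set \<beta> = S"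
    by (rule composition_with_descent_set[of S n]) (auto simp: S_def)
  have key: "i \<in> double_cover \<beta> \<longleftrightarrow> i \<in> descent_set \<alpha>" if i: "i \<in> {2..<n}" for i
  proof -
    have "i \<in> (\<lambda>b. b + 1) ` S \<longleftrightarrow> i - 1 \<in> S"
      using i by (auto simp: image_iff intro!: bexI[of _ "i - 1"])
    then have "i \<in> double_cover \<beta> \<longleftrightarrow> i \<notin> A \<and> (i + 1 \<notin> A \<or> i - 1 \<notin> A)"
      using i by (auto simp: double_cover_def \<beta>(3) S_def)
    \<comment> \<open>Two neighbours in \<open>A\<close> also force 3 \<le> i \<le> n - 2, the range
      required of an internal peak.\<close>
    moreover have False if "i \<notin> A" "i + 1 \<in> A" "i - 1 \<in> A"
    proof -
      have "internal_peak \<alpha> i"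
        using that i unfolding internal_peak_def A_def n_def by auto
      then show False using peak by blast
    qed
    ultimately show ?thesis using i by (auto simp: A_def)
  qed
  show thesis
  proof (rule that[of \<beta>])
    show "is_composition \<beta>" "sum_list \<beta> = sum_list \<alpha>"
      using \<beta> n_def by simp_all
    fix \<alpha>' assume "shifted_composition \<alpha>'" "sum_list \<alpha>' = sum_list \<alpha>"
    then have "descent_set \<alpha>' \<subseteq> {1..<n}" "1 \<notin> descent_set \<alpha>'"
      using descent_set_subset[of \<alpha>'] by (simp_all add: shifted_composition_iff n_def)
    then have "i \<in> {2..<n}" if "i \<in> descent_set \<alpha>'" for i
      using that by (cases "i = 1") auto
    then show "descent_set \<alpha>' \<subseteq> double_cover \<beta> \<longleftrightarrow> descent_set \<alpha>' \<subseteq> descent_set \<alpha>"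
      using key by blast
  qed
qed

text \<open>The triangularity: \<open>m\<close> is a pivot for \<alpha>, and in its row only
  compositions of the same total with a smaller or equal descent set survive.\<close>

lemma peak_free_test_monomial:
  assumes "\<alpha> \<in> peak_free_shifted_compositions"
  shows "\<exists>m. theta \<alpha> m \<noteq> 0 \<and> (\<forall>\<alpha>'\<in>peak_free_shifted_compositions. theta \<alpha>' m \<noteq> 0 \<longrightarrow>
    sum_list \<alpha>' = sum_list \<alpha> \<and> descent_set \<alpha>' \<subseteq> descent_set \<alpha>)"
proof (rule peak_free_test_composition[OF assms])
  fix \<beta>
  assume \<beta>: "is_composition \<beta>" "sum_list \<beta> = sum_list \<alpha>"
    "\<And>\<alpha>'. shifted_composition \<alpha>' \<Longrightarrow> sum_list \<alpha>' = sum_list \<alpha> \<Longrightarrow>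
       descent_set \<alpha>' \<subseteq> double_cover \<beta> \<longleftrightarrow> descent_set \<alpha>' \<subseteq> descent_set \<alpha>"
  let ?m = "monomial_of [0..<length \<beta>] \<beta>"
  have shifted: "shifted_composition \<alpha>'" if "\<alpha>' \<in> peak_free_shifted_compositions" for \<alpha>'
    using that by (simp add: peak_free_shifted_compositions_def)
  show ?thesis
  proof (intro exI[of _ ?m] conjI ballI impI)
    show "theta \<alpha> ?m \<noteq> 0"
      using \<beta>(2) \<beta>(3)[of \<alpha>] shifted[OF assms] by (simp add: theta_monomial_of[OF \<beta>(1)])
    fix \<alpha>' assume \<alpha>': "\<alpha>' \<in> peak_free_shifted_compositions" and "theta \<alpha>' ?m \<noteq> 0"
    then have *: "sum_list \<alpha>' = sum_list \<alpha>" "descent_set \<alpha>' \<subseteq> double_cover \<beta>"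
      using \<beta>(2) by (simp_all add: theta_monomial_of[OF \<beta>(1)] split: if_splits)
    then show "sum_list \<alpha>' = sum_list \<alpha>" "descent_set \<alpha>' \<subseteq> descent_set \<alpha>"
      using \<beta>(3)[OF shifted[OF \<alpha>']] by simp_all
  qed
qed

lemma peak_free_imp_composition:
  "\<alpha> \<in> peak_free_shifted_compositions \<Longrightarrow> is_composition \<alpha>"
  by (simp add: peak_free_shifted_compositions_def shifted_composition_def)

text \<open>The pivots of the two compositions give the two inclusions between their descent
  sets.\<close>

lemma inj_on_theta_peak_free: "inj_on theta peak_free_shifted_compositions"
proof (rule inj_onI)
  fix \<alpha> \<alpha>'
  assume \<alpha>: "\<alpha> \<in> peak_free_shifted_compositions" and \<alpha>': "\<alpha>' \<in> peak_free_shifted_compositions"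
    and eq: "theta \<alpha> = theta \<alpha>'"
  have "sum_list \<alpha>' = sum_list \<alpha> \<and> descent_set \<alpha>' \<subseteq> descent_set \<alpha>"
    using peak_free_test_monomial[OF \<alpha>] \<alpha>' eq by auto
  moreover have "descent_set \<alpha> \<subseteq> descent_set \<alpha>'"
    using peak_free_test_monomial[OF \<alpha>'] \<alpha> eq by auto
  ultimately show "\<alpha> = \<alpha>'"
    using \<alpha> \<alpha>' by (intro composition_eqI peak_free_imp_composition) auto
qed

lemma independent_theta_peak_free:
  "zmod.independent (theta ` peak_free_shifted_compositions)"
proof
  assume "zmod.dependent (theta ` peak_free_shifted_compositions)"
  then obtain t u where t: "finite t" "t \<subseteq> theta ` peak_free_shifted_compositions"
    "(\<Sum>v\<in>t. zscale (u v) v) = 0" "\<exists>v\<in>t. u v \<noteq> 0"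
    unfolding zmod.dependent_explicit by blast
  obtain T where T: "T \<subseteq> peak_free_shifted_compositions" "finite T" "t = theta ` T"
    using t(1,2) by (meson finite_subset_image)
  have inj: "inj_on theta T" using inj_on_theta_peak_free T(1) inj_on_subset by blast
  \<comment> \<open>Injectivity allows the relation to be indexed by compositions instead of by
    power series.\<close>
  define c where "c = u \<circ> theta"
  have zero: "(\<Sum>\<alpha>\<in>T. c \<alpha> * theta \<alpha> m) = 0" for m
  proof -
    have "(\<Sum>\<alpha>\<in>T. zscale (c \<alpha>) (theta \<alpha>)) m = 0"
      using t(3) inj by (simp add: T(3) sum.reindex c_def)
    then show ?thesis using T(2) by (simp add: sum_power_series_apply zscale_def)
  qed
  have "\<exists>\<alpha>. \<alpha> \<in> T \<and> c \<alpha> \<noteq> 0" using t(4) T(3) by (auto simp: c_def)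
  \<comment> \<open>A composition of least descent number suffices: any other term surviving at its
    pivot has a descent set that is contained in this one and is no smaller, hence equal.\<close>
  then have "\<exists>\<alpha>. (\<alpha> \<in> T \<and> c \<alpha> \<noteq> 0) \<and>
      (\<forall>\<alpha>'. \<alpha>' \<in> T \<and> c \<alpha>' \<noteq> 0 \<longrightarrow> card (descent_set \<alpha>) \<le> card (descent_set \<alpha>'))"
    by (elim exE) (rule ex_has_least_nat)
  then obtain \<alpha> where \<alpha>: "\<alpha> \<in> T" "c \<alpha> \<noteq> 0"
    and least: "\<And>\<alpha>'. \<alpha>' \<in> T \<Longrightarrow> c \<alpha>' \<noteq> 0 \<Longrightarrow> card (descent_set \<alpha>) \<le> card (descent_set \<alpha>')"
    by blast
  obtain m where m: "theta \<alpha> m \<noteq> 0"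
    "\<forall>\<alpha>'\<in>peak_free_shifted_compositions. theta \<alpha>' m \<noteq> 0 \<longrightarrow>
       sum_list \<alpha>' = sum_list \<alpha> \<and> descent_set \<alpha>' \<subseteq> descent_set \<alpha>"
    using peak_free_test_monomial[OF subsetD[OF T(1) \<alpha>(1)]] by (elim exE conjE)
  have "c \<alpha>' * theta \<alpha>' m = 0" if \<alpha>': "\<alpha>' \<in> T - {\<alpha>}" for \<alpha>'
  proof (rule ccontr)
    assume "c \<alpha>' * theta \<alpha>' m \<noteq> 0"
    then have nz: "c \<alpha>' \<noteq> 0" "theta \<alpha>' m \<noteq> 0" by auto
    have comp: "is_composition \<alpha>" "is_composition \<alpha>'"
      using \<alpha>(1) \<alpha>' T(1) peak_free_imp_composition by auto
    have *: "sum_list \<alpha>' = sum_list \<alpha>" "descent_set \<alpha>' \<subseteq> descent_set \<alpha>"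
      using m(2) \<alpha>' T(1) nz(2) by blast+
    have "descent_set \<alpha>' = descent_set \<alpha>"
      using finite_descent_set[OF comp(1)] *(2)
    proof (rule card_seteq)
      show "card (descent_set \<alpha>) \<le> card (descent_set \<alpha>')"
        using \<alpha>' nz(1) by (intro least) auto
    qed
    then have "\<alpha> = \<alpha>'" using *(1) by (intro composition_eqI comp) simp_all
    then show False using \<alpha>' by simp
  qed
  then have "(\<Sum>\<alpha>'\<in>T - {\<alpha>}. c \<alpha>' * theta \<alpha>' m) = 0" by (rule sum.neutral[OF ballI])
  then have "(\<Sum>\<alpha>\<in>T. c \<alpha> * theta \<alpha> m) = c \<alpha> * theta \<alpha> m"
    using sum.remove[OF T(2) \<alpha>(1), of "\<lambda>\<alpha>. c \<alpha> * theta \<alpha> m"] by simp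
  then show False using zero m(1) \<alpha>(2) by simp
qed

section \<open>Elimination of internal peaks\<close>

lemma theta_peak_relation:
  assumes sums: "sum_list \<alpha>1 = sum_list \<alpha>" "sum_list \<alpha>2 = sum_list \<alpha>" "sum_list \<alpha>3 = sum_list \<alpha>"
    and i: "i \<in> descent_set \<alpha>" "1 < i"
    and desc: "descent_set \<alpha>1 = insert (i - 1) (descent_set \<alpha>)"
      "descent_set \<alpha>2 = insert (i + 1) (descent_set \<alpha>)"
      "descent_set \<alpha>3 = insert (i - 1) (insert (i + 1) (descent_set \<alpha>))"
  shows "theta \<alpha> = theta \<alpha>1 + theta \<alpha>2 - theta \<alpha>3"
proof
  fix m
  let ?f = "\<lambda>\<alpha> \<beta>. of_bool (descent_set \<alpha> \<subseteq> double_cover \<beta>) :: int"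
  have "?f \<alpha> \<beta> = ?f \<alpha>1 \<beta> + ?f \<alpha>2 \<beta> - ?f \<alpha>3 \<beta>" for \<beta>
  proof -
    \<comment> \<open>Either \<open>i\<close> is a descent of \<beta>, which also covers
      \<open>i + 1\<close>, or \<open>i - 1\<close> is one, which covers itself. The indicator
      identity is then inclusion-exclusion for these two events.\<close>
    have "i - 1 \<in> double_cover \<beta> \<or> i + 1 \<in> double_cover \<beta>" if "descent_set \<alpha> \<subseteq> double_cover \<beta>"
    proof -
      have "i \<in> double_cover \<beta>" using that i by blast
      then show ?thesis by (auto simp: double_cover_def)
    qed
    then show ?thesis by (auto simp: desc of_bool_def)
  qed
  then have "theta \<alpha> m = (\<Sum>\<beta>\<in>compositions (sum_list \<alpha>).
      (?f \<alpha>1 \<beta> + ?f \<alpha>2 \<beta> - ?f \<alpha>3 \<beta>) * (2 ^ length \<beta> * monomial_qsym \<beta> m))"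
    unfolding theta_apply by (intro sum.cong) simp_all
  also have "\<dots> = theta \<alpha>1 m + theta \<alpha>2 m - theta \<alpha>3 m"
    unfolding theta_apply sums
    by (simp add: sum.distrib sum_subtractf distrib_right left_diff_distrib)
  finally show "theta \<alpha> m = (theta \<alpha>1 + theta \<alpha>2 - theta \<alpha>3) m" by simp
qed

text \<open>Rewriting at an internal peak only adds descents while the total stays fixed, so the
  number of missing descents drops and the process ends at peak-free compositions.\<close>

lemma theta_in_span_peak_free:
  assumes "shifted_composition \<alpha>"
  shows "theta \<alpha> \<in> zmod.span (theta ` peak_free_shifted_compositions)"
  using assms
proof (induction "sum_list \<alpha> - card (descent_set \<alpha>)" arbitrary: \<alpha> rule: less_induct)
  case less
  define n where "n = sum_list \<alpha>"
  have comp: "is_composition \<alpha>" and no1: "1 \<notin> descent_set \<alpha>"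
    using less.prems by (auto simp: shifted_composition_iff)
  have sub: "descent_set \<alpha> \<subseteq> {1..<n}"
    using descent_set_subset[OF comp] by (simp add: n_def)
  show ?case
  proof (cases "\<exists>i. internal_peak \<alpha> i")
    case False
    then show ?thesis using less.prems
      by (auto intro!: zmod.span_base simp: peak_free_shifted_compositions_def)
  next
    case True
    then obtain i where i: "i \<in> descent_set \<alpha>" "i - 1 \<notin> descent_set \<alpha>" "i + 1 \<notin> descent_set \<alpha>"
      "3 \<le> i" "i \<le> n - 2"
      by (auto simp: internal_peak_def n_def)
    have refine: "\<exists>\<gamma>. sum_list \<gamma> = n \<and> descent_set \<gamma> = S \<and>
        theta \<gamma> \<in> zmod.span (theta ` peak_free_shifted_compositions)"
      if S: "descent_set \<alpha> \<subset> S" "S \<subseteq> {1..<n}" "1 \<notin> S" for S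
    proof -
      obtain \<gamma> where \<gamma>: "is_composition \<gamma>" "sum_list \<gamma> = n" "descent_set \<gamma> = S"
        using composition_with_descent_set[OF S(2)] .
      have "card (descent_set \<alpha>) < card S"
        using S finite_subset[OF S(2)] by (intro psubset_card_mono) auto
      \<comment> \<open>This bound makes the decrease of the measure strict despite truncated
        subtraction.\<close>
      moreover have "card S \<le> n"
        using card_mono[OF _ S(2)] by simp
      ultimately have "theta \<gamma> \<in> zmod.span (theta ` peak_free_shifted_compositions)"
        using \<gamma> S by (intro less.hyps) (auto simp: n_def shifted_composition_iff)
      then show ?thesis using \<gamma> by blast
    qed
    \<comment> \<open>The bounds on an internal peak give 2 \<le> i - 1 and i + 1 < n, so the
      enlarged sets stay below \<open>n\<close> and still avoid 1: all three compositions are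
      shifted.\<close>
    obtain \<alpha>1 where \<alpha>1: "sum_list \<alpha>1 = n" "descent_set \<alpha>1 = insert (i - 1) (descent_set \<alpha>)"
      "theta \<alpha>1 \<in> zmod.span (theta ` peak_free_shifted_compositions)"
      using refine[of "insert (i - 1) (descent_set \<alpha>)"] i sub no1 by fastforce
    obtain \<alpha>2 where \<alpha>2: "sum_list \<alpha>2 = n" "descent_set \<alpha>2 = insert (i + 1) (descent_set \<alpha>)"
      "theta \<alpha>2 \<in> zmod.span (theta ` peak_free_shifted_compositions)"
      using refine[of "insert (i + 1) (descent_set \<alpha>)"] i sub no1 by fastforce
    obtain \<alpha>3 where \<alpha>3: "sum_list \<alpha>3 = n"
      "descent_set \<alpha>3 = insert (i - 1) (insert (i + 1) (descent_set \<alpha>))"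
      "theta \<alpha>3 \<in> zmod.span (theta ` peak_free_shifted_compositions)"
      using refine[of "insert (i - 1) (insert (i + 1) (descent_set \<alpha>))"] i sub no1 by fastforce
    have "theta \<alpha> = theta \<alpha>1 + theta \<alpha>2 - theta \<alpha>3"
      using \<alpha>1 \<alpha>2 \<alpha>3 i by (intro theta_peak_relation[of _ _ _ _ i]) (auto simp: n_def)
    then show ?thesis
      using \<alpha>1(3) \<alpha>2(3) \<alpha>3(3) by (simp add: zmod.span_add zmod.span_diff)
  qed
qed

theorem theorem4p2:
  shows "inj_on theta peak_free_shifted_compositions \<and>
    zmod.independent (theta ` peak_free_shifted_compositions) \<and>
    zmod.span (theta ` peak_free_shifted_compositions) = Xi"
proof (intro conjI inj_on_theta_peak_free independent_theta_peak_free)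
  show "zmod.span (theta ` peak_free_shifted_compositions) = Xi"
    unfolding Xi_def
  proof (rule antisym)
    show "zmod.span (theta ` peak_free_shifted_compositions) \<subseteq>
        zmod.span {theta \<alpha> |\<alpha>. shifted_composition \<alpha>}"
      by (rule zmod.span_mono) (auto simp: peak_free_shifted_compositions_def)
    show "zmod.span {theta \<alpha> |\<alpha>. shifted_composition \<alpha>} \<subseteq>
        zmod.span (theta ` peak_free_shifted_compositions)"
      by (rule zmod.span_minimal) (auto intro: theta_in_span_peak_free)
  qed
qed

end
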